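(* Let $D\ge1$, let $N_1,\dots,N_D$ and $M$ be positive integers, let $\Omega:=\prod_{d=1}^D\mathbb{Z}_{N_d}$, and let $R_1,\dots,R_M:\Omega\to\mathbb{R}$ be any functions. Let $A$ be a linear operator from $\ell(\Omega)=\{f\mid f:\Omega\to\mathbb{R}\}$ into itself. If $A$ is self-adjoint and $\langle Af,f\rangle\ge0$ for all $f:\Omega\to\{-1,0,1\}$, then the iteration $$\psi_i(n)=\min\Bigl(\operatorname*{argmax}_{1\le m\le M}\bigl[(A\mu_m^{(i-1)})(n)+R_m(n)\bigr]\Bigr),\qquad n\in\Omega,\ i\ge1,$$ where $\mu_m^{(i-1)}(n)=1$ if $\psi_{i-1}(n)=m$ and $\mu_m^{(i-1)}(n)=0$ otherwise, always converges; that is, for every initial $\psi_0:\Omega\to\{1,\dots,M\}$ there exists $i_0\ge0$ such that $\psi_i=\psi_{i_0}$ for all $i\ge i_0$.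
   Context: The inner product on $\ell(\Omega)$ is the standard real one, $\langle f,h\rangle=\sum_{n\in\Omega}f(n)h(n)$, and self-adjointness is with respect to it. The expression $\operatorname{argmax}$ denotes the set of all maximizing $m$, so ties are broken by choosing the smallest maximizing $m$. *)

theory Defs
  imports Complex_Main "HOL-Algebra.Elementary_Groups" "HOL-Algebra.Product_Groups"
begin

text \<open>Points of \<open>\<Omega>\<close> are extensional functions from the index set \<open>{1..D}\<close> to residues,
  the residues modulo \<open>N d\<close> being the integers \<open>0, \<dots>, N d - 1\<close> when \<open>N d > 0\<close>.\<close>

definition Omega :: "nat \<Rightarrow> (nat \<Rightarrow> nat) \<Rightarrow> (nat \<Rightarrow> int) set" where
  "Omega D N = carrier (product_group {1..D} (\<lambda>d. integer_mod_group (N d)))"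

text \<open>Functions on a set \<open>X\<close> are extensional (\<open>undefined\<close> off \<open>X\<close>), so that equality of two such
  functions is equality on \<open>X\<close>; the pointwise vector space operations are restricted accordingly.\<close>

definition ell :: "'a set \<Rightarrow> ('a \<Rightarrow> real) set" where
  "ell X = X \<rightarrow>\<^sub>E UNIV"

definition linear_operator_on :: "'a set \<Rightarrow> (('a \<Rightarrow> real) \<Rightarrow> ('a \<Rightarrow> real)) \<Rightarrow> bool" where
  "linear_operator_on X A \<longleftrightarrow>
     A \<in> ell X \<rightarrow> ell X \<and>
     (\<forall>f\<in>ell X. \<forall>h\<in>ell X. A (\<lambda>n\<in>X. f n + h n) = (\<lambda>n\<in>X. A f n + A h n)) \<and>
     (\<forall>c. \<forall>f\<in>ell X. A (\<lambda>n\<in>X. c * f n) = (\<lambda>n\<in>X. c * A f n))"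

definition inner_on :: "'a set \<Rightarrow> ('a \<Rightarrow> real) \<Rightarrow> ('a \<Rightarrow> real) \<Rightarrow> real" where
  "inner_on X f h = (\<Sum>n\<in>X. f n * h n)"

definition self_adjoint_on :: "'a set \<Rightarrow> (('a \<Rightarrow> real) \<Rightarrow> ('a \<Rightarrow> real)) \<Rightarrow> bool" where
  "self_adjoint_on X A \<longleftrightarrow>
     (\<forall>f\<in>ell X. \<forall>h\<in>ell X. inner_on X (A f) h = inner_on X f (A h))"

definition argmax_set :: "'b set \<Rightarrow> ('b \<Rightarrow> real) \<Rightarrow> 'b set" where
  "argmax_set S v = {m. is_arg_max v (\<lambda>k. k \<in> S) m}"

definition phase_indicator :: "'a set \<Rightarrow> ('a \<Rightarrow> nat) \<Rightarrow> nat \<Rightarrow> 'a \<Rightarrow> real" where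
  "phase_indicator X \<psi> m = (\<lambda>n\<in>X. if \<psi> n = m then 1 else 0)"

primrec phase_iter ::
  "'a set \<Rightarrow> nat \<Rightarrow> (('a \<Rightarrow> real) \<Rightarrow> ('a \<Rightarrow> real)) \<Rightarrow> (nat \<Rightarrow> 'a \<Rightarrow> real) \<Rightarrow> ('a \<Rightarrow> nat) \<Rightarrow> nat
     \<Rightarrow> 'a \<Rightarrow> nat" where
  "phase_iter X M A R \<psi>0 0 = \<psi>0"
| "phase_iter X M A R \<psi>0 (Suc i) =
     (\<lambda>n\<in>X. Min (argmax_set {1..M}
        (\<lambda>m. A (phase_indicator X (phase_iter X M A R \<psi>0 i) m) n + R m n)))"

end

theory Submission
  imports Defs
begin

text \<open>The iteration is an ascent method. To a labelling \<open>\<psi>\<close> with indicators \<open>\<mu>\<^sub>m\<close> assign the energy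
  \<open>E \<psi> = (\<Sum>m. \<langle>A \<mu>\<^sub>m, \<mu>\<^sub>m\<rangle> + 2 \<langle>R\<^sub>m, \<mu>\<^sub>m\<rangle>)\<close>. For a second labelling \<open>\<phi>\<close> with indicators
  \<open>\<nu>\<^sub>m\<close>, self-adjointness turns the energy difference into
  \<open>E \<phi> - E \<psi> = (\<Sum>m. \<langle>A (\<nu>\<^sub>m - \<mu>\<^sub>m), \<nu>\<^sub>m - \<mu>\<^sub>m\<rangle>) + 2 (\<Sum>n. v\<^sub>n (\<phi> n) - v\<^sub>n (\<psi> n))\<close>,
  where \<open>v\<^sub>n m = (A \<mu>\<^sub>m) n + R\<^sub>m n\<close> is the score that one step of the iteration maximizes at
  \<open>n\<close> (lemma \<open>energy_diff\<close>). The functions \<open>\<nu>\<^sub>m - \<mu>\<^sub>m\<close> take only the values \<open>-1, 0, 1\<close>, so the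
  first sum is nonnegative by hypothesis; when \<open>\<phi>\<close> is the successor of \<open>\<psi>\<close> each summand of the
  second sum is nonnegative too, by maximality. Hence the energy never decreases along the iteration.

  There are only finitely many labellings, so the energy is eventually constant. From then on
  the old label of each point maximizes its score just as the new one does, and since ties go to the
  smallest label, the labels can only go down (lemma \<open>step_le_of_energy_le\<close>). Labels are natural
  numbers, so they too are eventually constant.\<close>

section \<open>Monotone sequences with finite range\<close>

lemma incseq_finite_range_eventually_const:
  fixes f :: "nat \<Rightarrow> 'a::linorder"
  assumes mono: "incseq f" and fin: "finite (range f)"
  shows "\<exists>i0. \<forall>i\<ge>i0. f i = f i0"
proof -
  have "Max (range f) \<in> range f"
    using fin by (intro Max_in) auto
  then obtain i0 where i0: "Max (range f) = f i0" by auto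
  have "f i = f i0" if "i \<ge> i0" for i
  proof (rule antisym)
    show "f i \<le> f i0" using fin i0 by (metis Max_ge rangeI)
    show "f i0 \<le> f i" using mono that by (simp add: incseqD)
  qed
  then show ?thesis by blast
qed

text \<open>Finiteness of the index set allows the pointwise order to be traced by a single number, the
  sum of all values.\<close>

lemma pointwise_antimono_eventually_const:
  fixes \<psi> :: "nat \<Rightarrow> 'a \<Rightarrow> nat"
  assumes X: "finite X"
    and ext: "\<And>i. \<psi> i \<in> extensional X"
    and dec: "\<And>i n. n \<in> X \<Longrightarrow> \<psi> (Suc i) n \<le> \<psi> i n"
  shows "\<exists>i0. \<forall>i\<ge>i0. \<psi> i = \<psi> i0"
proof -
  define s where "s i = - int (\<Sum>n\<in>X. \<psi> i n)" for i
  have inc: "incseq s"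
    by (rule incseq_SucI) (auto simp: s_def intro!: sum_mono dec simp flip: of_nat_sum)
  have "range s \<subseteq> {s 0..0}"
    using inc by (auto simp: incseq_def) (simp add: s_def sum_nonneg)
  then have "finite (range s)"
    by (rule finite_subset) simp
  from incseq_finite_range_eventually_const[OF inc this]
  obtain i0 where i0: "\<And>i. i \<ge> i0 \<Longrightarrow> s i = s i0" by blast
  have step: "\<psi> (Suc i) = \<psi> i" if "i \<ge> i0" for i
  proof (rule extensionalityI[OF ext ext])
    fix n assume n: "n \<in> X"
    have "s (Suc i) = s i"
      using i0[of i] i0[of "Suc i"] that by simp
    then have "(\<Sum>n\<in>X. \<psi> (Suc i) n) = (\<Sum>n\<in>X. \<psi> i n)"
      unfolding s_def by linarith
    then show "\<psi> (Suc i) n = \<psi> i n"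
      by (rule sum_mono_inv[OF _ dec n X])
  qed
  have "\<psi> i = \<psi> i0" if "i \<ge> i0" for i
    using that by (induction i rule: dec_induct) (auto simp: step)
  then show ?thesis by blast
qed

section \<open>Energy of a labelling\<close>

lemma phase_indicator_in_ell: "phase_indicator X \<psi> m \<in> ell X"
  by (simp add: phase_indicator_def ell_def)

text \<open>The energy gains from the linear terms are collected by label, whereas one step of the
  iteration optimizes point by point; this exchange of summation connects the two.\<close>

lemma sum_inner_phase_indicator:
  assumes "finite X" and "\<And>n. n \<in> X \<Longrightarrow> \<psi> n \<in> {1..M}"
  shows "(\<Sum>m=1..M. inner_on X (v m) (phase_indicator X \<psi> m)) = (\<Sum>n\<in>X. v (\<psi> n) n)"
proof -
  have "(\<Sum>m=1..M. inner_on X (v m) (phase_indicator X \<psi> m))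
      = (\<Sum>n\<in>X. \<Sum>m=1..M. v m n * (if \<psi> n = m then 1 else 0))"
    unfolding inner_on_def phase_indicator_def by (subst sum.swap) simp
  also have "\<dots> = (\<Sum>n\<in>X. v (\<psi> n) n)"
  proof (rule sum.cong[OF refl])
    fix n assume "n \<in> X"
    then have "\<psi> n \<in> {1..M}" by (rule assms)
    then show "(\<Sum>m=1..M. v m n * (if \<psi> n = m then 1 else 0)) = v (\<psi> n) n"
      by (simp add: if_distrib[of "(*) _"] cong: if_cong)
  qed
  finally show ?thesis .
qed

text \<open>This is the second-order Taylor expansion of \<open>f \<mapsto> \<langle>A f, f\<rangle>\<close>; self-adjointness merges the two
  mixed terms.\<close>

lemma quadratic_form_diff:
  assumes lin: "linear_operator_on X A" and sa: "self_adjoint_on X A"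
    and f: "f \<in> ell X" and g: "g \<in> ell X"
  defines "d \<equiv> (\<lambda>n\<in>X. g n - f n)"
  shows "inner_on X (A g) g - inner_on X (A f) f = inner_on X (A d) d + 2 * inner_on X (A f) d"
proof -
  have d: "d \<in> ell X" by (simp add: d_def ell_def)
  have g_eq: "g = (\<lambda>n\<in>X. f n + d n)"
    using g by (intro ext) (auto simp: d_def ell_def PiE_def extensional_def)
  have "A (\<lambda>n\<in>X. f n + d n) = (\<lambda>n\<in>X. A f n + A d n)"
    using lin f d unfolding linear_operator_on_def by blast
  then have Ag: "A g = (\<lambda>n\<in>X. A f n + A d n)"
    using g_eq by simp
  have "inner_on X (A g) g = (\<Sum>n\<in>X. (A f n + A d n) * (f n + d n))"
    unfolding inner_on_def Ag by (subst g_eq) simp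
  also have "\<dots> = inner_on X (A f) f + inner_on X (A f) d + inner_on X (A d) f + inner_on X (A d) d"
    by (simp add: inner_on_def algebra_simps sum.distrib)
  also have "inner_on X (A d) f = inner_on X d (A f)"
    using sa f d unfolding self_adjoint_on_def by blast
  also have "\<dots> = inner_on X (A f) d"
    by (simp add: inner_on_def mult.commute)
  finally show ?thesis by simp
qed

definition energy ::
  "'a set \<Rightarrow> nat \<Rightarrow> (('a \<Rightarrow> real) \<Rightarrow> ('a \<Rightarrow> real)) \<Rightarrow> (nat \<Rightarrow> 'a \<Rightarrow> real) \<Rightarrow> ('a \<Rightarrow> nat) \<Rightarrow> real"
  where
  "energy X M A R \<psi> =
     (\<Sum>m=1..M. inner_on X (A (phase_indicator X \<psi> m)) (phase_indicator X \<psi> m)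
              + 2 * inner_on X (R m) (phase_indicator X \<psi> m))"

definition score ::
  "'a set \<Rightarrow> (('a \<Rightarrow> real) \<Rightarrow> ('a \<Rightarrow> real)) \<Rightarrow> (nat \<Rightarrow> 'a \<Rightarrow> real) \<Rightarrow> ('a \<Rightarrow> nat) \<Rightarrow> nat \<Rightarrow> 'a \<Rightarrow> real"
  where "score X A R \<psi> m n = A (phase_indicator X \<psi> m) n + R m n"

text \<open>The factor 2 on the linear part of the energy matches the factor 2 that the mixed term of
  the quadratic expansion carries, so that the first-order change of the energy is exactly twice
  the change of the scores.\<close>

lemma energy_diff:
  assumes X: "finite X"
    and lin: "linear_operator_on X A" and sa: "self_adjoint_on X A"
    and \<psi>: "\<And>n. n \<in> X \<Longrightarrow> \<psi> n \<in> {1..M}" and \<phi>: "\<And>n. n \<in> X \<Longrightarrow> \<phi> n \<in> {1..M}"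
  defines "d \<equiv> (\<lambda>m. \<lambda>n\<in>X. phase_indicator X \<phi> m n - phase_indicator X \<psi> m n)"
  shows "energy X M A R \<phi> - energy X M A R \<psi>
       = (\<Sum>m=1..M. inner_on X (A (d m)) (d m))
         + 2 * (\<Sum>n\<in>X. score X A R \<psi> (\<phi> n) n - score X A R \<psi> (\<psi> n) n)"
proof -
  let ?\<mu> = "phase_indicator X \<psi>" and ?\<nu> = "phase_indicator X \<phi>" and ?v = "score X A R \<psi>"
  have summand: "(inner_on X (A (?\<nu> m)) (?\<nu> m) + 2 * inner_on X (R m) (?\<nu> m))
      - (inner_on X (A (?\<mu> m)) (?\<mu> m) + 2 * inner_on X (R m) (?\<mu> m))
      = inner_on X (A (d m)) (d m)
        + 2 * (inner_on X (?v m) (?\<nu> m) - inner_on X (?v m) (?\<mu> m))" for m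
  proof -
    have "inner_on X (A (?\<nu> m)) (?\<nu> m) - inner_on X (A (?\<mu> m)) (?\<mu> m)
        = inner_on X (A (d m)) (d m) + 2 * inner_on X (A (?\<mu> m)) (d m)"
      unfolding d_def
      by (rule quadratic_form_diff[OF lin sa phase_indicator_in_ell phase_indicator_in_ell])
    moreover have "inner_on X (A (?\<mu> m)) (d m) + inner_on X (R m) (?\<nu> m) - inner_on X (R m) (?\<mu> m)
        = inner_on X (?v m) (?\<nu> m) - inner_on X (?v m) (?\<mu> m)"
      by (simp add: inner_on_def d_def score_def algebra_simps sum.distrib sum_subtractf)
    ultimately show ?thesis by argo
  qed
  have "energy X M A R \<phi> - energy X M A R \<psi>
      = (\<Sum>m=1..M. inner_on X (A (d m)) (d m))
        + 2 * ((\<Sum>m=1..M. inner_on X (?v m) (?\<nu> m)) - (\<Sum>m=1..M. inner_on X (?v m) (?\<mu> m)))"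
    unfolding energy_def sum_subtractf[symmetric] summand
    by (simp add: sum.distrib sum_distrib_left)
  also have "(\<Sum>m=1..M. inner_on X (?v m) (?\<nu> m)) = (\<Sum>n\<in>X. ?v (\<phi> n) n)"
    by (rule sum_inner_phase_indicator[OF X \<phi>])
  also have "(\<Sum>m=1..M. inner_on X (?v m) (?\<mu> m)) = (\<Sum>n\<in>X. ?v (\<psi> n) n)"
    by (rule sum_inner_phase_indicator[OF X \<psi>])
  finally show ?thesis by (simp add: sum_subtractf)
qed

section \<open>One step of the iteration\<close>

lemma mem_argmax_set_iff: "m \<in> argmax_set S v \<longleftrightarrow> m \<in> S \<and> (\<forall>k\<in>S. v k \<le> v m)"
  by (auto simp: argmax_set_def is_arg_max_def not_less)

lemma Min_argmax_set_mem:
  fixes S :: "'b::linorder set"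
  assumes "finite S" and "S \<noteq> {}"
  shows "Min (argmax_set S v) \<in> argmax_set S v"
proof (rule Min_in)
  show "finite (argmax_set S v)"
    by (rule finite_subset[OF _ assms(1)]) (auto simp: mem_argmax_set_iff)
  have "Max (v ` S) \<in> v ` S" using assms by (intro Max_in) auto
  then obtain m where "m \<in> S" "v m = Max (v ` S)" by auto
  then have "m \<in> argmax_set S v"
    using assms by (auto simp: mem_argmax_set_iff)
  then show "argmax_set S v \<noteq> {}" by blast
qed

definition phase_step ::
  "'a set \<Rightarrow> nat \<Rightarrow> (('a \<Rightarrow> real) \<Rightarrow> ('a \<Rightarrow> real)) \<Rightarrow> (nat \<Rightarrow> 'a \<Rightarrow> real) \<Rightarrow> ('a \<Rightarrow> nat)
     \<Rightarrow> 'a \<Rightarrow> nat" where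
  "phase_step X M A R \<psi> = (\<lambda>n\<in>X. Min (argmax_set {1..M} (\<lambda>m. score X A R \<psi> m n)))"

lemma phase_iter_Suc_eq_step:
  "phase_iter X M A R \<psi>0 (Suc i) = phase_step X M A R (phase_iter X M A R \<psi>0 i)"
  by (simp add: phase_step_def score_def)

lemma phase_step_mem_argmax:
  assumes "M > 0" and "n \<in> X"
  shows "phase_step X M A R \<psi> n \<in> argmax_set {1..M} (\<lambda>m. score X A R \<psi> m n)"
  using assms Min_argmax_set_mem[of "{1..M}" "\<lambda>m. score X A R \<psi> m n"]
  by (simp add: phase_step_def)

lemma phase_step_le:
  assumes "n \<in> X" and "m \<in> argmax_set {1..M} (\<lambda>m. score X A R \<psi> m n)"
  shows "phase_step X M A R \<psi> n \<le> m"
proof -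
  have "finite (argmax_set {1..M} (\<lambda>m. score X A R \<psi> m n))"
    by (rule finite_subset[of _ "{1..M}"]) (auto simp: mem_argmax_set_iff)
  then show ?thesis using assms by (simp add: phase_step_def)
qed

lemma phase_step_in:
  assumes "M > 0"
  shows "phase_step X M A R \<psi> \<in> X \<rightarrow>\<^sub>E {1..M}"
proof (rule PiE_I)
  show "phase_step X M A R \<psi> n \<in> {1..M}" if "n \<in> X" for n
    using phase_step_mem_argmax[OF assms that, of A R \<psi>] by (simp add: mem_argmax_set_iff)
qed (simp add: phase_step_def)

lemma phase_iter_in:
  assumes "M > 0" and "\<psi>0 \<in> X \<rightarrow>\<^sub>E {1..M}"
  shows "phase_iter X M A R \<psi>0 i \<in> X \<rightarrow>\<^sub>E {1..M}"
  using assms by (cases i) (simp_all only: phase_iter_Suc_eq_step phase_step_in phase_iter.simps(1))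

text \<open>The bound holds because the discarded part of the energy difference, the quadratic form, is
  evaluated at differences of indicators.\<close>

lemma energy_step_gain:
  assumes X: "finite X" and M: "M > 0"
    and lin: "linear_operator_on X A" and sa: "self_adjoint_on X A"
    and nonneg: "\<And>f. f \<in> X \<rightarrow>\<^sub>E {-1, 0, 1} \<Longrightarrow> inner_on X (A f) f \<ge> 0"
    and \<psi>: "\<psi> \<in> X \<rightarrow>\<^sub>E {1..M}"
  shows "2 * (\<Sum>n\<in>X. score X A R \<psi> (phase_step X M A R \<psi> n) n - score X A R \<psi> (\<psi> n) n)
       \<le> energy X M A R (phase_step X M A R \<psi>) - energy X M A R \<psi>"
proof -
  let ?\<phi> = "phase_step X M A R \<psi>"
  let ?d = "\<lambda>m. \<lambda>n\<in>X. phase_indicator X ?\<phi> m n - phase_indicator X \<psi> m n"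
  have "?d m \<in> X \<rightarrow>\<^sub>E {-1, 0, 1}" for m
    by (auto simp: phase_indicator_def)
  then have "0 \<le> (\<Sum>m=1..M. inner_on X (A (?d m)) (?d m))"
    by (intro sum_nonneg nonneg)
  moreover have "energy X M A R ?\<phi> - energy X M A R \<psi>
      = (\<Sum>m=1..M. inner_on X (A (?d m)) (?d m))
        + 2 * (\<Sum>n\<in>X. score X A R \<psi> (?\<phi> n) n - score X A R \<psi> (\<psi> n) n)"
    by (rule energy_diff[OF X lin sa PiE_mem[OF \<psi>] PiE_mem[OF phase_step_in[OF M]]])
  ultimately show ?thesis by linarith
qed

lemma score_le_score_step:
  assumes "M > 0" and "\<psi> \<in> X \<rightarrow>\<^sub>E {1..M}" and "n \<in> X"
  shows "score X A R \<psi> (\<psi> n) n \<le> score X A R \<psi> (phase_step X M A R \<psi> n) n"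
  using phase_step_mem_argmax[of M n X A R \<psi>] PiE_mem[of \<psi> X "\<lambda>_. {1..M}" n] assms
  by (auto simp: mem_argmax_set_iff)

lemma energy_le_energy_step:
  assumes "finite X" and "M > 0"
    and "linear_operator_on X A" and "self_adjoint_on X A"
    and "\<And>f. f \<in> X \<rightarrow>\<^sub>E {-1, 0, 1} \<Longrightarrow> inner_on X (A f) f \<ge> 0"
    and "\<psi> \<in> X \<rightarrow>\<^sub>E {1..M}"
  shows "energy X M A R \<psi> \<le> energy X M A R (phase_step X M A R \<psi>)"
proof -
  have "0 \<le> (\<Sum>n\<in>X. score X A R \<psi> (phase_step X M A R \<psi> n) n - score X A R \<psi> (\<psi> n) n)"
    using score_le_score_step[OF assms(2,6)] by (intro sum_nonneg) simp
  with energy_step_gain[OF assms, of R] show ?thesis by linarith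
qed

text \<open>Without an energy gain every score gain vanishes, so the old labels are themselves maximizers
  and compete in the minimum that breaks ties.\<close>

lemma step_le_of_energy_le:
  assumes X: "finite X" and M: "M > 0"
    and "linear_operator_on X A" and "self_adjoint_on X A"
    and "\<And>f. f \<in> X \<rightarrow>\<^sub>E {-1, 0, 1} \<Longrightarrow> inner_on X (A f) f \<ge> 0"
    and \<psi>: "\<psi> \<in> X \<rightarrow>\<^sub>E {1..M}"
    and le: "energy X M A R (phase_step X M A R \<psi>) \<le> energy X M A R \<psi>"
    and n: "n \<in> X"
  shows "phase_step X M A R \<psi> n \<le> \<psi> n"
proof (rule phase_step_le[OF n])
  let ?gain = "\<lambda>n. score X A R \<psi> (phase_step X M A R \<psi> n) n - score X A R \<psi> (\<psi> n) n"
  have gain: "?gain k \<ge> 0" if "k \<in> X" for k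
    using score_le_score_step[OF M \<psi> that] by simp
  have "?gain n \<le> (\<Sum>k\<in>X. ?gain k)"
    using X n gain by (intro member_le_sum) auto
  also have "\<dots> \<le> 0"
    using energy_step_gain[OF assms(1-6), of R] le by linarith
  finally have "score X A R \<psi> (phase_step X M A R \<psi> n) n \<le> score X A R \<psi> (\<psi> n) n"
    by simp
  then show "\<psi> n \<in> argmax_set {1..M} (\<lambda>m. score X A R \<psi> m n)"
    using phase_step_mem_argmax[OF M n, of A R \<psi>] PiE_mem[OF \<psi> n]
    by (fastforce simp: mem_argmax_set_iff)
qed

section \<open>Convergence\<close>

theorem phase_iter_eventually_const:
  assumes X: "finite X" and M: "M > 0"
    and lin: "linear_operator_on X A" and sa: "self_adjoint_on X A"
    and nonneg: "\<And>f. f \<in> X \<rightarrow>\<^sub>E {-1, 0, 1} \<Longrightarrow> inner_on X (A f) f \<ge> 0"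
    and \<psi>0: "\<psi>0 \<in> X \<rightarrow>\<^sub>E {1..M}"
  shows "\<exists>i0. \<forall>i\<ge>i0. phase_iter X M A R \<psi>0 i = phase_iter X M A R \<psi>0 i0"
proof -
  let ?\<psi> = "phase_iter X M A R \<psi>0" and ?E = "energy X M A R"
  note in_labels = phase_iter_in[OF M \<psi>0]
  have inc: "incseq (\<lambda>i. ?E (?\<psi> i))"
    by (rule incseq_SucI)
      (simp only: phase_iter_Suc_eq_step energy_le_energy_step[OF X M lin sa nonneg in_labels])
  have "finite (X \<rightarrow>\<^sub>E {1..M})"
    using X by (intro finite_PiE) auto
  moreover have "range (\<lambda>i. ?E (?\<psi> i)) \<subseteq> ?E ` (X \<rightarrow>\<^sub>E {1..M})"
    using in_labels by blast
  ultimately have "finite (range (\<lambda>i. ?E (?\<psi> i)))"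
    by (meson finite_imageI finite_subset)
  from incseq_finite_range_eventually_const[OF inc this]
  obtain j where j: "\<And>i. i \<ge> j \<Longrightarrow> ?E (?\<psi> i) = ?E (?\<psi> j)" by blast
  have "\<exists>k. \<forall>i\<ge>k. ?\<psi> (j + i) = ?\<psi> (j + k)"
  proof (rule pointwise_antimono_eventually_const[OF X])
    show "?\<psi> (j + i) \<in> extensional X" for i
      using in_labels[of A R "j + i"] by (simp add: PiE_def)
    fix i n assume n: "n \<in> X"
    have "?E (?\<psi> (Suc (j + i))) \<le> ?E (?\<psi> (j + i))"
      using j[of "Suc (j + i)"] j[of "j + i"] by simp
    from step_le_of_energy_le[OF X M lin sa nonneg in_labels this[unfolded phase_iter_Suc_eq_step] n]
    show "?\<psi> (j + Suc i) n \<le> ?\<psi> (j + i) n"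
      unfolding add_Suc_right phase_iter_Suc_eq_step
      by blast
  qed
  then obtain k where k: "\<And>i. i \<ge> k \<Longrightarrow> ?\<psi> (j + i) = ?\<psi> (j + k)" by blast
  have "?\<psi> i = ?\<psi> (j + k)" if "i \<ge> j + k" for i
    using k[of "i - j"] that by simp
  then show ?thesis by blast
qed

lemma finite_Omega:
  assumes "\<And>d. d \<in> {1..D} \<Longrightarrow> N d > 0"
  shows "finite (Omega D N)"
  unfolding Omega_def carrier_product_group
  using assms by (intro finite_PiE) (fastforce simp: carrier_integer_mod_group)+

theorem theorem2p2:
  fixes D M :: nat
    and N :: "nat \<Rightarrow> nat"
    and R :: "nat \<Rightarrow> (nat \<Rightarrow> int) \<Rightarrow> real"
    and A :: "((nat \<Rightarrow> int) \<Rightarrow> real) \<Rightarrow> ((nat \<Rightarrow> int) \<Rightarrow> real)"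
  assumes "D \<ge> 1"
    and "\<And>d. d \<in> {1..D} \<Longrightarrow> N d > 0"
    and "M > 0"
    and "\<And>m. m \<in> {1..M} \<Longrightarrow> R m \<in> ell (Omega D N)"
    and "linear_operator_on (Omega D N) A"
    and "self_adjoint_on (Omega D N) A"
    and "\<And>f. f \<in> Omega D N \<rightarrow>\<^sub>E {-1, 0, 1} \<Longrightarrow> inner_on (Omega D N) (A f) f \<ge> 0"
  shows "\<forall>\<psi>0 \<in> Omega D N \<rightarrow>\<^sub>E {1..M}.
           \<exists>i0. \<forall>i\<ge>i0. phase_iter (Omega D N) M A R \<psi>0 i = phase_iter (Omega D N) M A R \<psi>0 i0"
proof
  fix \<psi>0 assume \<psi>0: "\<psi>0 \<in> Omega D N \<rightarrow>\<^sub>E {1..M}"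
  show "\<exists>i0. \<forall>i\<ge>i0.
      phase_iter (Omega D N) M A R \<psi>0 i = phase_iter (Omega D N) M A R \<psi>0 i0"
    by (rule phase_iter_eventually_const[OF finite_Omega[OF assms(2)] assms(3,5-7) \<psi>0])
qed

end
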